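(* Let $w_0:[0,\infty)\to[0,\infty)$ be a decreasing integrable function with $\int_0^\infty w_0(x)\,dx=1$, which is initial data for the linear LSW system and satisfies $L(0)=1$. Let $X_0$ be the random variable associated with $w_0$ and $\beta_0(\cdot)$ its beta function, and suppose $\sup\beta_0(\cdot)<\infty$. Let $w(x,t)$, $x\ge0$, $t\ge0$, be the solution of the linear LSW system with initial data $w_0$. Suppose in addition that $\lim_{x\to\|X_0\|_\infty}\beta_0(x)=\beta_\infty>0$. Then $$\lim_{T\to\infty}\frac{\Lambda(T)}{T}=\beta_\infty .$$
   Context: Beta function. For a nonnegative decreasing integrable function $w$ on $[0,\infty)$ (not identically zero) let $X$ be the associated positive random variable, with $P(X>x)=w(x)/w(0)$, let $\|X\|_\infty\in(0,\infty]$ be its essential supremum, and let $h(x)=\int_x^\infty w(x')\,dx'$. Assuming $h$ is $C^2$ on $[0,\|X\|_\infty)$, the beta function of $w$ (or of $X$) is $\beta(x)=h''(x)h(x)/h'(x)^2$, $0\le x<\|X\|_\infty$. Linear LSW system. It consists of $$\frac{\partial w(x,t)}{\partial t}=\left[1-\frac{x}{L(t)}\right]\frac{\partial w}{\partial x}(x,t),\quad x>0,\ t>0,\qquad \int_0^\infty w(x,t)\,dx=1,$$ with $w(x,0)=w_0(x)$; the function $L(t)>0$ is determined by the integral constraint and is given by $L(t)=\int_0^\infty w(x,t)\,dx\,/\,w(0,t)$ (also at $t=0$). Solutions are understood via characteristics: $L$ is continuous and positive and $w(x,t)=w_0(F(x,t))$, where $F(x,t)=x(0)$ and $x(s)$,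 $0\le s\le t$, solves $dx/ds=-[1-x/L(s)]$, $x(t)=x$. With $c(\cdot,t)=-\partial w(\cdot,t)/\partial x$, the mean cluster volume is $\Lambda(t)=\int_0^\infty x\,c(x,t)\,dx\big/\int_0^\infty c(x,t)\,dx=1/w(0,t)$. *)

theory Defs
  imports "HOL-Probability.Probability"
begin

text \<open>Functions on \<open>[0, \<infinity>)\<close> are total functions on the reals of which only the values at
  nonnegative arguments matter.\<close>

definition tail_integral :: "(real \<Rightarrow> real) \<Rightarrow> real \<Rightarrow> real" where
  "tail_integral w x = (LBINT y:{x..}. w y)"

definition associated_rv :: "'a measure \<Rightarrow> ('a \<Rightarrow> real) \<Rightarrow> (real \<Rightarrow> real) \<Rightarrow> bool" where
  "associated_rv M X w \<longleftrightarrow> prob_space M \<and> X \<in> borel_measurable M \<and>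
     (\<forall>x\<ge>0. measure M {\<omega> \<in> space M. X \<omega> > x} = w x / w 0)"

definition rv_sup :: "'a measure \<Rightarrow> ('a \<Rightarrow> real) \<Rightarrow> ereal" where
  "rv_sup M X = esssup M (\<lambda>\<omega>. ereal (X \<omega>))"

definition below :: "ereal \<Rightarrow> real set" where
  "below S = {x. 0 \<le> x \<and> ereal x < S}"

text \<open>All derivatives are taken relative to the interval, hence are one-sided at its
  endpoint \<open>0\<close>.\<close>

definition deriv_within :: "real set \<Rightarrow> (real \<Rightarrow> real) \<Rightarrow> real \<Rightarrow> real" where
  "deriv_within I f x = vector_derivative f (at x within I)"

definition C2_on :: "real set \<Rightarrow> (real \<Rightarrow> real) \<Rightarrow> bool" where
  "C2_on I f \<longleftrightarrow> f differentiable_on I \<and> deriv_within I f differentiable_on I \<and>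
     continuous_on I (deriv_within I (deriv_within I f))"

definition beta_function :: "ereal \<Rightarrow> (real \<Rightarrow> real) \<Rightarrow> real \<Rightarrow> real" where
  "beta_function S w x =
     (let h = tail_integral w; h' = deriv_within (below S) h; h'' = deriv_within (below S) h'
      in h'' x * h x / (h' x)\<^sup>2)"

definition characteristic :: "(real \<Rightarrow> real) \<Rightarrow> real \<Rightarrow> real \<Rightarrow> (real \<Rightarrow> real) \<Rightarrow> bool" where
  "characteristic L x t \<xi> \<longleftrightarrow>
     (\<forall>s\<in>{0..t}. (\<xi> has_real_derivative - (1 - \<xi> s / L s)) (at s within {0..t})) \<and> \<xi> t = x"

text \<open>The characteristic through \<open>(x, t)\<close> is unique, as it solves a linear equation with
  continuous coefficients; so \<open>\<xi> 0\<close> below is the value \<open>F(x, t)\<close> of the characteristic flow.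
  At \<open>t = 0\<close> the condition reduces to \<open>w(x, 0) = w\<^sub>0(x)\<close>.\<close>

definition linear_LSW_solution ::
    "(real \<Rightarrow> real) \<Rightarrow> (real \<Rightarrow> real \<Rightarrow> real) \<Rightarrow> (real \<Rightarrow> real) \<Rightarrow> bool" where
  "linear_LSW_solution w0 w L \<longleftrightarrow>
     continuous_on {0..} L \<and> (\<forall>t\<ge>0. L t > 0) \<and>
     (\<forall>x\<ge>0. \<forall>t\<ge>0. \<exists>\<xi>. characteristic L x t \<xi> \<and> w x t = w0 (\<xi> 0)) \<and>
     (\<forall>t\<ge>0. set_integrable lborel {0..} (\<lambda>x. w x t) \<and> (LBINT x:{0..}. w x t) = 1) \<and>
     (\<forall>t\<ge>0. L t = (LBINT x:{0..}. w x t) / w 0 t)"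

text \<open>Points where \<open>w(\<cdot>, t)\<close> is not differentiable get an arbitrary value of \<open>deriv\<close>.
  For the solutions considered here there are at most two of them (\<open>x = 0\<close>, and the
  right end of the support), and the integrals do not see them.\<close>

definition cluster_density :: "(real \<Rightarrow> real \<Rightarrow> real) \<Rightarrow> real \<Rightarrow> real \<Rightarrow> real" where
  "cluster_density w x t = - deriv (\<lambda>y. w y t) x"

definition mean_cluster_volume :: "(real \<Rightarrow> real \<Rightarrow> real) \<Rightarrow> real \<Rightarrow> real" where
  "mean_cluster_volume w t =
     (LBINT x:{0..}. x * cluster_density w x t) / (LBINT x:{0..}. cluster_density w x t)"

end

theory Submission
  imports Defs "HOL-Real_Asymp.Real_Asymp"
begin

text \<open>With \<open>b\<close> and \<open>a\<close> determined by \<open>F(x, t) = x / a(t) + b(t)\<close>, the characteristic flow gives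
  \<open>w(x, t) = w\<^sub>0(x / a(t) + b(t))\<close> and \<open>b' = 1 / a\<close>. The constraint \<open>\<integral> w(x, t) dx = 1\<close> says
  \<open>a(t) h(b(t)) = 1\<close>. Hence \<open>b\<close> solves the autonomous equation \<open>b' = h(b)\<close>, \<open>b(0) = 0\<close>, and
  \<open>L(t) = 1 / w(0, t) = 1 / w\<^sub>0(b(t))\<close> (lemma \<open>time_change_exists\<close>).

  Since \<open>h' = - w\<^sub>0\<close>, the chain rule gives
  \<open>L'(t) = - w\<^sub>0'(b) h(b) / w\<^sub>0(b)\<^sup>2 = \<beta>\<^sub>0(b(t))\<close> (lemma \<open>mean_DERIV\<close>).
  The solution \<open>b\<close> cannot stall below the right end \<open>S = \<parallel>X\<^sub>0\<parallel>\<^sub>\<infinity>\<close>, because \<open>h > 0\<close> there; so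
  \<open>b(t)\<close> increases to \<open>S\<close>, \<open>L'(t) \<longlonglongrightarrow> \<beta>\<^sub>\<infinity>\<close>, and \<open>L(t) / t \<longlonglongrightarrow> \<beta>\<^sub>\<infinity>\<close> by l'Hospital's rule.

  It remains to identify \<open>\<Lambda>(t)\<close> with \<open>L(t)\<close>. After the substitution \<open>y = x / a + b\<close> this amounts to
  \<open>\<integral> - w\<^sub>0'(y) dy = w\<^sub>0(b)\<close> and \<open>\<integral> (y - b) (- w\<^sub>0'(y)) dy = h(b)\<close> over \<open>(b, S)\<close>, that is, to the
  vanishing at \<open>S\<close> of \<open>w\<^sub>0(y)\<close>, \<open>y w\<^sub>0(y)\<close> and \<open>h(y)\<close>. All three limits are taken along
  \<open>y = b(t)\<close>, which treats finite and infinite \<open>S\<close> alike: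
  \<open>w\<^sub>0(b(t)) = 1 / L(t)\<close> vanishes because \<open>L\<close> grows linearly (this uses \<open>\<beta>\<^sub>\<infinity> > 0\<close> and
  excludes an atom of \<open>X\<^sub>0\<close> at \<open>S\<close>); \<open>h(b(t))\<close> vanishes by dominated convergence; and then
  \<open>b(t) / t \<longlonglongrightarrow> 0\<close>, so \<open>b(t) w\<^sub>0(b(t)) = (b(t) / t) / (L(t) / t)\<close> vanishes too.\<close>

section \<open>Calculus on the half-line and the characteristic flow\<close>

lemma antiderivative_halfline:
  fixes f :: "real \<Rightarrow> real"
  assumes "continuous_on {0..} f"
  obtains F where "F 0 = 0" "\<And>t. 0 \<le> t \<Longrightarrow> (F has_real_derivative f t) (at t within {0..})"
proof -
  have "((\<lambda>u. integral {0..u} f) has_real_derivative f t) (at t within {0..})"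
    if t: "0 \<le> t" for t
  proof -
    have "((\<lambda>u. integral {0..u} f) has_real_derivative f t) (at t within {0..t + 1})"
      using t by (intro integral_has_real_derivative continuous_on_subset[OF assms]) auto
    moreover have "at t within {0..t + 1} = at t within {0..}"
      by (rule at_within_nhd[of _ "{..<t + 1}"]) auto
    ultimately show ?thesis by simp
  qed
  then show thesis using that[of "\<lambda>u. integral {0..u} f"] by simp
qed

lemma halfline_nondecreasing:
  fixes F :: "real \<Rightarrow> real"
  assumes F: "\<And>t. 0 \<le> t \<Longrightarrow> (F has_real_derivative f t) (at t within {0..})"
    and f: "\<And>t. 0 \<le> t \<Longrightarrow> 0 \<le> f t" and st: "0 \<le> s" "s \<le> t"
  shows "F s \<le> F t"
proof (rule DERIV_nonneg_imp_increasing_open[OF st(2)])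
  fix x assume "s < x" "x < t"
  then have "at x within {0..} = at x"
    using st by (intro at_within_open_subset[of _ "{0<..}"]) auto
  then show "\<exists>y. (F has_real_derivative y) (at x) \<and> 0 \<le> y"
    using F[of x] f[of x] st \<open>s < x\<close> by auto
next
  have "continuous_on {0..} F"
    by (rule DERIV_continuous_on) (use F in auto)
  then show "continuous_on {s..t} F"
    by (rule continuous_on_subset) (use st in auto)
qed

text \<open>Along a characteristic \<open>\<xi>(s) exp (- A(s)) + B(s)\<close> is constant, where \<open>A\<close> and \<open>B\<close> are the
  primitives of \<open>1 / L\<close> and \<open>exp (- A)\<close>. This makes \<open>F(x, t)\<close> explicit.\<close>

lemma characteristic_origin:
  assumes L: "\<And>s. 0 \<le> s \<Longrightarrow> 0 < L s"
    and A: "\<And>s. 0 \<le> s \<Longrightarrow> (A has_real_derivative 1 / L s) (at s within {0..})" "A 0 = 0"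
    and B: "\<And>s. 0 \<le> s \<Longrightarrow> (B has_real_derivative exp (- A s)) (at s within {0..})" "B 0 = 0"
    and \<xi>: "characteristic L x t \<xi>" and t: "0 \<le> t"
  shows "\<xi> 0 = x * exp (- A t) + B t"
proof -
  define \<phi> where "\<phi> s = \<xi> s * exp (- A s) + B s" for s
  have "(\<phi> has_real_derivative 0) (at s within {0..t})" if s: "s \<in> {0..t}" for s
  proof -
    have 1: "(A has_real_derivative 1 / L s) (at s within {0..t})"
      "(B has_real_derivative exp (- A s)) (at s within {0..t})"
      using s by (auto intro!: DERIV_subset[OF A(1)] DERIV_subset[OF B(1)])
    have 2: "(\<xi> has_real_derivative - (1 - \<xi> s / L s)) (at s within {0..t})"
      using \<xi> s by (auto simp: characteristic_def)
    show ?thesis unfolding \<phi>_def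
      by (rule derivative_eq_intros 1 2 refl)+ (simp add: algebra_simps)
  qed
  then obtain c where "\<And>s. s \<in> {0..t} \<Longrightarrow> \<phi> s = c"
    using has_field_derivative_zero_constant[of "{0..t}" \<phi>] by auto
  then have "\<phi> 0 = \<phi> t" using t by simp
  then show ?thesis
    using \<xi> by (simp add: \<phi>_def A(2) B(2) characteristic_def)
qed

lemma tail_integral_affine:
  assumes "0 < c"
  shows "(LBINT x:{0..}. f (x * c + b)) = tail_integral f b / c"
proof -
  have "tail_integral f b = c * (\<integral>x. indicator {b..} (b + c * x) *\<^sub>R f (b + c * x) \<partial>lborel)"
    unfolding tail_integral_def set_lebesgue_integral_def
    using assms by (subst lborel_integral_real_affine[where c = c and t = b]) auto
  also have "(\<lambda>x. indicator {b..} (b + c * x) *\<^sub>R f (b + c * x))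
      = (\<lambda>x. indicator {0..} x *\<^sub>R f (x * c + b))"
    using assms by (auto simp: fun_eq_iff indicator_def zero_le_mult_iff algebra_simps)
  finally show ?thesis
    using assms by (simp add: set_lebesgue_integral_def)
qed

section \<open>The survival function of the initial random variable\<close>

text \<open>In particular the survival function vanishes at the essential supremum itself, if that is
  finite.\<close>

lemma associated_rv_pos_iff:
  assumes rv: "associated_rv M X w" and w0: "0 < w 0" and x: "0 \<le> x"
  shows "0 < w x \<longleftrightarrow> ereal x < rv_sup M X"
proof -
  interpret prob_space M using rv by (simp add: associated_rv_def)
  have X[measurable]: "X \<in> borel_measurable M" using rv by (simp add: associated_rv_def)
  have "0 < w x \<longleftrightarrow> 0 < prob {\<omega> \<in> space M. x < X \<omega>}"
    using rv x w0 by (simp add: associated_rv_def zero_less_divide_iff)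
  also have "\<dots> \<longleftrightarrow> ereal x < rv_sup M X"
  proof
    assume pos: "0 < prob {\<omega> \<in> space M. x < X \<omega>}"
    show "ereal x < rv_sup M X"
    proof (rule ccontr)
      assume "\<not> ereal x < rv_sup M X"
      then have le: "rv_sup M X \<le> ereal x" by simp
      have "AE \<omega> in M. ereal (X \<omega>) \<le> rv_sup M X"
        unfolding rv_sup_def by (rule esssup_AE)
      then have "AE \<omega> in M. \<not> x < X \<omega>"
      proof eventually_elim
        fix \<omega> assume "ereal (X \<omega>) \<le> rv_sup M X"
        then have "ereal (X \<omega>) \<le> ereal x" using le by (rule order_trans)
        then show "\<not> x < X \<omega>" by simp
      qed
      then have "prob {\<omega> \<in> space M. x < X \<omega>} = 0" by (subst prob_Collect_eq_0) auto
      then show False using pos by simp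
    qed
  next
    assume "ereal x < rv_sup M X"
    then have "0 < emeasure M {\<omega> \<in> space M. ereal x < ereal (X \<omega>)}"
      unfolding rv_sup_def by (intro esssup_pos_measure) auto
    then show "0 < prob {\<omega> \<in> space M. x < X \<omega>}"
      by (simp add: emeasure_eq_measure)
  qed
  finally show ?thesis .
qed

lemma associated_rv_right_continuous:
  assumes rv: "associated_rv M X w" and w0: "0 < w 0" and x: "0 \<le> x"
  shows "continuous (at_right x) w"
proof -
  interpret prob_space M using rv by (simp add: associated_rv_def)
  have X[measurable]: "X \<in> borel_measurable M" using rv by (simp add: associated_rv_def)
  interpret D: real_distribution "distr M borel X" by (rule real_distribution_distr) (rule X)
  have cdf: "w y = w 0 * (1 - cdf (distr M borel X) y)" if y: "0 \<le> y" for y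
  proof -
    have "{\<omega> \<in> space M. y < X \<omega>} = space M - {\<omega> \<in> space M. X \<omega> \<le> y}" by auto
    then have "prob {\<omega> \<in> space M. y < X \<omega>} = 1 - prob {\<omega> \<in> space M. X \<omega> \<le> y}"
      by (simp add: prob_compl)
    moreover have "cdf (distr M borel X) y = prob {\<omega> \<in> space M. X \<omega> \<le> y}"
      by (simp add: cdf_def measure_distr vimage_def Int_def conj_commute)
    moreover have "prob {\<omega> \<in> space M. y < X \<omega>} = w y / w 0"
      using rv y by (simp add: associated_rv_def)
    ultimately show ?thesis using w0 by (simp add: field_simps)
  qed
  have "((\<lambda>y. w 0 * (1 - cdf (distr M borel X) y)) \<longlongrightarrow> w 0 * (1 - cdf (distr M borel X) x)) (at_right x)"
    using D.cdf_is_right_cont[of x] by (intro tendsto_intros) (simp add: continuous_within)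
  then have "(w \<longlongrightarrow> w x) (at_right x)"
    unfolding cdf[OF x, symmetric]
    by (rule Lim_transform_eventually)
      (use x in \<open>auto intro!: eventually_at_rightI[of x "x + 1"] simp: cdf[symmetric]\<close>)
  then show ?thesis by (simp add: continuous_within)
qed

section \<open>Smooth initial profiles\<close>

text \<open>An initial profile that is integrable, decreasing, right continuous, positive exactly to the
  left of \<open>S\<close>, and whose tail integral is \<open>C\<^sup>2\<close> on \<open>[0, S)\<close>. No random variable
  is involved: \<open>S\<close> is only the right end of the set where the profile is positive.\<close>

locale tail_profile =
  fixes S :: ereal and w0 :: "real \<Rightarrow> real"
  assumes nonneg: "\<And>x. 0 \<le> x \<Longrightarrow> 0 \<le> w0 x"
    and antimono: "antimono_on {0..} w0"
    and integrable: "set_integrable lborel {0..} w0"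
    and pos_iff: "\<And>x. 0 \<le> x \<Longrightarrow> 0 < w0 x \<longleftrightarrow> ereal x < S"
    and right_continuous: "\<And>x. 0 \<le> x \<Longrightarrow> continuous (at_right x) w0"
    and C2: "C2_on (below S) (tail_integral w0)"
begin

abbreviation h :: "real \<Rightarrow> real" where "h \<equiv> tail_integral w0"

text \<open>The second derivative of the tail integral on \<open>[0, S)\<close>, which is \<open>- w\<^sub>0'\<close> there: the initial
  cluster density. Outside \<open>[0, S)\<close> its value is irrelevant.\<close>

definition g :: "real \<Rightarrow> real" where
  "g = deriv_within (below S) (deriv_within (below S) h)"

lemma antimonoD: "0 \<le> x \<Longrightarrow> x \<le> y \<Longrightarrow> w0 y \<le> w0 x"
  using antimono by (auto simp: monotone_on_def)

lemma below_iff: "x \<in> below S \<longleftrightarrow> 0 \<le> x \<and> 0 < w0 x"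
  using pos_iff by (auto simp: below_def)

lemma right_segment_below:
  assumes "x \<in> below S"
  obtains z where "x < z" "{x..z} \<subseteq> below S"
proof -
  obtain z where "ereal x < ereal z" "ereal z < S"
    using assms ereal_dense2[of "ereal x" S] by (auto simp: below_def)
  moreover have "{x..z} \<subseteq> below S"
    using assms \<open>ereal z < S\<close> by (auto simp: below_def intro: le_less_trans[of _ "ereal z"])
  ultimately show ?thesis using that by auto
qed

lemma below_nontrivial: "x \<in> below S \<Longrightarrow> at x within below S \<noteq> bot"
  by (metis right_segment_below at_within_Icc_at_right at_le bot.extremum_uniqueI
      trivial_limit_at_right_real)

lemma at_within_below: "0 < x \<Longrightarrow> ereal x < S \<Longrightarrow> at x within below S = at x"
  by (rule at_within_open_subset[of _ "einterval 0 S", OF _ open_einterval])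
    (auto simp: einterval_iff below_def)

lemma tail_integrable: "0 \<le> x \<Longrightarrow> set_integrable lborel {x..} w0"
  by (rule set_integrable_subset[OF integrable]) auto

text \<open>The integral on the right is the Henstock--Kurzweil one, for which the fundamental theorem
  with pointwise continuity is available.\<close>

lemma tail_split:
  assumes "0 \<le> x" "x \<le> z"
  shows "h x = integral {x..z} w0 + h z"
proof -
  have i: "set_integrable lborel {x..z} w0"
    by (rule set_integrable_subset[OF integrable]) (use assms in auto)
  have "integral ({x..z} \<union> {z..}) w0 = integral {x..z} w0 + integral {z..} w0"
  proof (rule integral_Un)
    show "negligible ({x..z} \<inter> {z..})"
      using assms by (intro negligible_subset[OF negligible_sing[of z]]) auto
  qed (use i assms tail_integrable[of z] set_borel_integral_eq_integral in auto)
  moreover have "{x..z} \<union> {z..} = {x..}" using assms by auto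
  ultimately show ?thesis
    using assms tail_integrable[of x] tail_integrable[of z]
    by (simp add: tail_integral_def set_borel_integral_eq_integral)
qed

lemma tail_nonneg: "0 \<le> x \<Longrightarrow> 0 \<le> h x"
  unfolding tail_integral_def set_lebesgue_integral_def
  by (auto intro!: Bochner_Integration.integral_nonneg nonneg simp: indicator_def)

lemma tail_antimono: "0 \<le> x \<Longrightarrow> x \<le> z \<Longrightarrow> h z \<le> h x"
  unfolding tail_integral_def set_lebesgue_integral_def
  using tail_integrable[of x] tail_integrable[of z]
  by (auto intro!: integral_mono nonneg simp: indicator_def set_integrable_def)

text \<open>The profile is not assumed continuous, so the fundamental theorem only yields the right
  derivative \<open>- w\<^sub>0(x)\<close> of \<open>h\<close>. As \<open>h\<close> is differentiable, that right derivative is the derivative.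
  It follows that \<open>w\<^sub>0\<close> is \<open>C\<^sup>1\<close> on \<open>[0, S)\<close>.\<close>

lemma tail_derivative:
  assumes x: "x \<in> below S"
  shows "(h has_real_derivative - w0 x) (at x within below S)"
    and "deriv_within (below S) h x = - w0 x"
proof -
  have x0: "0 \<le> x" using x by (simp add: below_def)
  obtain z where z: "x < z" "{x..z} \<subseteq> below S" by (rule right_segment_below[OF x])
  have "set_integrable lborel {x..z} w0"
    by (rule set_integrable_subset[OF integrable]) (use x0 in auto)
  then have "w0 integrable_on {x..z}" by (rule set_borel_integral_eq_integral)
  moreover have "continuous (at x within {x..z}) w0"
    using right_continuous[OF x0] z by (simp add: at_within_Icc_at_right)
  ultimately have "((\<lambda>u. integral {x..u} w0) has_vector_derivative w0 x) (at x within {x..z})"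
    using integral_has_vector_derivative_continuous_at[of w0 x z x "{}"] z by simp
  then have "((\<lambda>u. h x - integral {x..u} w0) has_vector_derivative - w0 x) (at x within {x..z})"
    by (auto intro!: derivative_eq_intros)
  then have right: "(h has_vector_derivative - w0 x) (at x within {x..z})"
    by (rule has_vector_derivative_transform[rotated 2]) (use z x0 tail_split[of x] in auto)
  obtain D where D: "(h has_vector_derivative D) (at x within below S)"
    using C2 x by (metis C2_on_def differentiable_on_def vector_derivative_works)
  then have "(h has_vector_derivative D) (at x within {x..z})"
    using z(2) by (rule has_vector_derivative_within_subset)
  moreover have "at x within {x..z} \<noteq> bot" using z by (simp add: at_within_Icc_at_right)
  ultimately have "D = - w0 x"
    using right vector_derivative_unique_within by blast
  then show d: "(h has_real_derivative - w0 x) (at x within below S)"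
    using D by (simp add: has_real_derivative_iff_has_vector_derivative)
  then show "deriv_within (below S) h x = - w0 x"
    unfolding deriv_within_def
    by (metis below_nontrivial x has_real_derivative_iff_has_vector_derivative
       vector_derivative_within)
qed

lemma profile_derivative:
  assumes x: "x \<in> below S"
  shows "(w0 has_real_derivative - g x) (at x within below S)"
proof -
  have "(deriv_within (below S) h has_real_derivative g x) (at x within below S)"
    using C2 x unfolding C2_on_def differentiable_on_def g_def deriv_within_def[of "below S" "deriv_within _ _"]
    by (simp add: has_real_derivative_iff_has_vector_derivative vector_derivative_works)
  then have "((\<lambda>y. - deriv_within (below S) h y) has_real_derivative - g x) (at x within below S)"
    by (rule DERIV_minus)
  then show ?thesis
    by (rule has_field_derivative_transform_within[where d = 1])
      (use x tail_derivative(2) in auto)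
qed

lemma tail_DERIV: "0 < x \<Longrightarrow> ereal x < S \<Longrightarrow> (h has_real_derivative - w0 x) (at x)"
  using tail_derivative(1)[of x] at_within_below[of x] by (simp add: below_def)

lemma profile_DERIV: "0 < x \<Longrightarrow> ereal x < S \<Longrightarrow> (w0 has_real_derivative - g x) (at x)"
  using profile_derivative[of x] at_within_below[of x] by (simp add: below_def)

lemma g_isCont: "0 < x \<Longrightarrow> ereal x < S \<Longrightarrow> isCont g x"
  using C2 at_within_below[of x] unfolding C2_on_def g_def[symmetric]
  by (metis below_iff continuous_on_eq_continuous_within less_imp_le pos_iff)

lemma g_nonneg:
  assumes "0 < x" "ereal x < S"
  shows "0 \<le> g x"
proof (rule ccontr)
  assume "\<not> 0 \<le> g x"
  then obtain d where "d > 0" "\<And>e. 0 < e \<Longrightarrow> e < d \<Longrightarrow> w0 x < w0 (x + e)"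
    using DERIV_pos_inc_right[OF profile_DERIV[OF assms]] by auto
  then have "w0 x < w0 (x + d / 2)" by simp
  then show False using antimonoD[of x "x + d / 2"] assms \<open>d > 0\<close> by simp
qed

lemma beta_function_eq:
  "x \<in> below S \<Longrightarrow> beta_function S w0 x = g x * h x / (w0 x)\<^sup>2"
  by (simp add: beta_function_def Let_def g_def[symmetric] tail_derivative(2))

lemma tail_pos:
  assumes x: "x \<in> below S"
  shows "0 < h x"
proof -
  obtain z where z: "x < z" "{x..z} \<subseteq> below S" by (rule right_segment_below[OF x])
  have x0: "0 \<le> x" using x by (simp add: below_def)
  obtain d where d: "d > 0" "\<And>e. 0 < e \<Longrightarrow> x + e \<in> below S \<Longrightarrow> e < d \<Longrightarrow> h (x + e) < h x"
    using has_real_derivative_neg_dec_right[OF tail_derivative(1)[OF x]] x by (auto simp: below_iff)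
  define e where "e = min (d / 2) (z - x)"
  have "h (x + e) < h x"
    using d(1) z by (intro d(2)) (auto simp: e_def min_def subset_iff)
  moreover have "0 \<le> h (x + e)"
    using d(1) z x0 by (intro tail_nonneg) (simp add: e_def)
  ultimately show ?thesis by linarith
qed

lemma tail_right_continuous:
  assumes x: "x \<in> below S"
  shows "continuous (at_right x) h"
proof -
  obtain z where z: "x < z" "{x..z} \<subseteq> below S" by (rule right_segment_below[OF x])
  have "continuous (at x within {x..z}) h"
    using tail_derivative(1)[OF x] z(2) by (meson DERIV_continuous continuous_within_subset)
  then show ?thesis using z(1) by (simp add: at_within_Icc_at_right)
qed

text \<open>The linear LSW system reduces to the scalar equation \<open>B' = h(B)\<close>: conservation of mass
  identifies the contraction factor \<open>exp (- A(t)) = 1 / a(t)\<close> of the flow with \<open>h(B(t))\<close>.\<close>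

lemma time_change_exists:
  assumes sol: "linear_LSW_solution w0 w L"
  obtains B where "B 0 = 0"
    "\<And>t. 0 \<le> t \<Longrightarrow> (B has_real_derivative h (B t)) (at t within {0..})"
    "\<And>t. 0 \<le> t \<Longrightarrow> B t \<in> below S"
    "\<And>t. 0 \<le> t \<Longrightarrow> L t = 1 / w0 (B t)"
    "\<And>x t. 0 \<le> x \<Longrightarrow> 0 \<le> t \<Longrightarrow> w x t = w0 (x * h (B t) + B t)"
proof -
  have Lpos: "0 < L t" if "0 \<le> t" for t
    using sol that unfolding linear_LSW_solution_def by blast
  have "continuous_on {0..} (\<lambda>s. 1 / L s)"
    using sol Lpos by (intro continuous_intros) (force simp: linear_LSW_solution_def)+
  then obtain A where A: "A 0 = 0" "\<And>t. 0 \<le> t \<Longrightarrow> (A has_real_derivative 1 / L t) (at t within {0..})"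
    by (rule antiderivative_halfline) blast
  have "continuous_on {0..} A" by (rule DERIV_continuous_on) (use A in auto)
  then have "continuous_on {0..} (\<lambda>s. exp (- A s))" by (intro continuous_intros)
  then obtain B where B: "B 0 = 0"
      "\<And>t. 0 \<le> t \<Longrightarrow> (B has_real_derivative exp (- A t)) (at t within {0..})"
    by (rule antiderivative_halfline) blast
  have B0: "0 \<le> B t" if "0 \<le> t" for t
    using halfline_nondecreasing[OF B(2), of 0 t] B(1) that by simp
  have w: "w x t = w0 (x * exp (- A t) + B t)" if xt: "0 \<le> x" "0 \<le> t" for x t
  proof -
    obtain \<xi> where "characteristic L x t \<xi>" "w x t = w0 (\<xi> 0)"
      using sol xt unfolding linear_LSW_solution_def by blast
    then show ?thesis
      using characteristic_origin[OF Lpos A(2) A(1) B(2) B(1)] xt by simp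
  qed
  have hB: "h (B t) = exp (- A t)" if t: "0 \<le> t" for t
  proof -
    have "1 = (LBINT x:{0..}. w x t)"
      using sol t by (simp add: linear_LSW_solution_def)
    also have "\<dots> = (LBINT x:{0..}. w0 (x * exp (- A t) + B t))"
      by (rule set_lebesgue_integral_cong) (use w t in auto)
    also have "\<dots> = h (B t) / exp (- A t)" by (rule tail_integral_affine) simp
    finally show ?thesis by (simp add: field_simps)
  qed
  have L: "L t = 1 / w0 (B t)" if t: "0 \<le> t" for t
  proof -
    have "L t = (LBINT x:{0..}. w x t) / w 0 t" "(LBINT x:{0..}. w x t) = 1"
      using sol t unfolding linear_LSW_solution_def by blast+
    then show ?thesis using w[of 0 t] t by simp
  qed
  have "B t \<in> below S" if t: "0 \<le> t" for t
    using Lpos[OF t] L[OF t] B0[OF t] by (simp add: below_iff)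
  then show thesis
    using that[of B] B L w hB by simp
qed

text \<open>Integration of \<open>- w\<^sub>0'\<close> and of \<open>(y - b) (- w\<^sub>0')\<close>, with primitives \<open>- w\<^sub>0\<close> and
  \<open>- (y - b) w\<^sub>0 - h\<close>. Integrability comes for free, since the integrands are nonnegative.\<close>

lemma gap_integrals:
  assumes b: "b \<in> below S"
    and w_lim: "((w0 \<circ> real_of_ereal) \<longlongrightarrow> 0) (at_left S)"
    and yw_lim: "(((\<lambda>y. y * w0 y) \<circ> real_of_ereal) \<longlongrightarrow> 0) (at_left S)"
    and h_lim: "((h \<circ> real_of_ereal) \<longlongrightarrow> 0) (at_left S)"
  shows "(LBINT y=b..S. g y) = w0 b" and "(LBINT y=b..S. (y - b) * g y) = h b"
proof -
  have b': "ereal b < S" "0 \<le> b" using b by (auto simp: below_def)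
  have pos: "0 < y" if "ereal b < ereal y" for y using that b' by simp
  have w_b: "(w0 \<longlongrightarrow> w0 b) (at_right b)"
    using right_continuous[OF b'(2)] by (simp add: continuous_within)
  have h_b: "(h \<longlongrightarrow> h b) (at_right b)"
    using tail_right_continuous[OF b] by (simp add: continuous_within)
  have "(LBINT y=b..S. g y) = 0 - (- w0 b)"
  proof (rule interval_integral_FTC_nonneg(2)[where F = "\<lambda>y. - w0 y"])
    show "((\<lambda>y. - w0 y) has_real_derivative g y) (at y)" if "ereal b < ereal y" "ereal y < S" for y
      using DERIV_minus[OF profile_DERIV[OF pos[OF that(1)] that(2)]] by simp
    show "(((\<lambda>y. - w0 y) \<circ> real_of_ereal) \<longlongrightarrow> - w0 b) (at_right (ereal b))"
      unfolding ereal_tendsto_simps1 by (intro tendsto_minus w_b)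
    show "(((\<lambda>y. - w0 y) \<circ> real_of_ereal) \<longlongrightarrow> 0) (at_left S)"
      using tendsto_minus[OF w_lim] by (simp add: comp_def)
  qed (use b' pos g_isCont g_nonneg in auto)
  then show "(LBINT y=b..S. g y) = w0 b" by simp
  have "(LBINT y=b..S. (y - b) * g y) = 0 - (- h b)"
  proof (rule interval_integral_FTC_nonneg(2)[where F = "\<lambda>y. - ((y - b) * w0 y) - h y"])
    show "((\<lambda>y. - ((y - b) * w0 y) - h y) has_real_derivative (y - b) * g y) (at y)"
      if y: "ereal b < ereal y" "ereal y < S" for y
      by (rule derivative_eq_intros refl profile_DERIV[OF pos[OF y(1)] y(2)]
          tail_DERIV[OF pos[OF y(1)] y(2)])+ (simp add: algebra_simps)
    show "isCont (\<lambda>y. (y - b) * g y) y" if y: "ereal b < ereal y" "ereal y < S" for y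
      by (intro continuous_intros g_isCont pos y)
    have "((\<lambda>y. - ((y - b) * w0 y) - h y) \<longlongrightarrow> - ((b - b) * w0 b) - h b) (at_right b)"
      by (intro tendsto_intros w_b h_b)
    then show "(((\<lambda>y. - ((y - b) * w0 y) - h y) \<circ> real_of_ereal) \<longlongrightarrow> - h b) (at_right (ereal b))"
      unfolding ereal_tendsto_simps1 by simp
    have "((\<lambda>u. - (real_of_ereal u * w0 (real_of_ereal u) - b * w0 (real_of_ereal u))
        - h (real_of_ereal u)) \<longlongrightarrow> - (0 - b * 0) - 0) (at_left S)"
      using w_lim yw_lim h_lim unfolding comp_def by (intro tendsto_intros)
    then show "(((\<lambda>y. - ((y - b) * w0 y) - h y) \<circ> real_of_ereal) \<longlongrightarrow> 0) (at_left S)"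
      by (simp add: comp_def algebra_simps)
  qed (use b' pos g_nonneg in auto)
  then show "(LBINT y=b..S. (y - b) * g y) = h b" by simp
qed

text \<open>The cluster density of a rescaled profile. Beyond the image of \<open>S\<close> the profile is constantly
  zero; the image of \<open>S\<close> and the origin have to be excluded.\<close>

lemma deriv_rescaled_profile:
  assumes f: "\<And>x. 0 \<le> x \<Longrightarrow> f x = w0 (x * e + b)" and e: "0 < e" and b: "0 \<le> b"
    and x: "0 < x" "ereal (x * e + b) \<noteq> S"
  shows "- deriv f x = e * (indicator (einterval b S) (x * e + b) * g (x * e + b))"
proof (cases "ereal (x * e + b) < S")
  case True
  have y: "0 < x * e + b" using x e b by (simp add: add_pos_nonneg)
  have "((\<lambda>x. w0 (x * e + b)) has_real_derivative - g (x * e + b) * e) (at x)"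
    by (rule DERIV_chain2[where f = w0 and g = "\<lambda>x. x * e + b", OF profile_DERIV[OF y True]])
      (auto intro!: derivative_eq_intros)
  then have "(f has_real_derivative - g (x * e + b) * e) (at x)"
    by (rule has_field_derivative_transform_within_open[of _ _ _ "{0<..}"]) (use x f in auto)
  then show ?thesis
    using True e x by (simp add: DERIV_imp_deriv einterval_iff)
next
  case False
  then have gt: "S < ereal (x * e + b)" using x by auto
  then obtain r where r: "S < ereal r" "ereal r < ereal (x * e + b)" by (metis ereal_dense2)
  have "((\<lambda>_. 0) has_real_derivative 0) (at x)" by simp
  then have "(f has_real_derivative 0) (at x)"
  proof (rule has_field_derivative_transform_within_open[of _ _ _ "{0<..} \<inter> {z. r < z * e + b}"])
    show "open ({0<..} \<inter> {z. r < z * e + b})"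
      by (intro open_Int open_Collect_less continuous_intros open_greaterThan)
    fix z assume z: "z \<in> {0<..} \<inter> {z. r < z * e + b}"
    then have "ereal r \<le> ereal (z * e + b)" by simp
    then have "\<not> ereal (z * e + b) < S" using r(1) by (metis less_trans not_le)
    then have "\<not> 0 < w0 (z * e + b)" using pos_iff z e b by (simp add: add_nonneg_nonneg)
    then have "w0 (z * e + b) = 0" using z e b nonneg[of "z * e + b"] by force
    then show "0 = f z" using z f[of z] by simp
  qed (use x r in auto)
  then show ?thesis using False by (simp add: DERIV_imp_deriv einterval_iff)
qed

text \<open>The substitution \<open>y = x e + b\<close>. If \<open>S = \<infinity>\<close> then \<open>real_of_ereal S = 0\<close>, and the excluded set
  contains a superfluous point, which is harmless.\<close>

lemma rescaled_density_integrals: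
  assumes f: "\<And>x. 0 \<le> x \<Longrightarrow> f x = w0 (x * e + b)" and e: "0 < e" and b: "b \<in> below S"
  shows "(LBINT x:{0..}. \<psi> (x * e) * - deriv f x) = (LBINT y=b..S. \<psi> (y - b) * g y)"
proof -
  have b': "0 \<le> b" "ereal b < S" using b by (auto simp: below_def)
  let ?k = "\<lambda>y. indicator (einterval b S) y *\<^sub>R (\<psi> (y - b) * g y)"
  have "(LBINT y=b..S. \<psi> (y - b) * g y) = (\<integral>y. ?k y \<partial>lborel)"
    using b' by (simp add: interval_lebesgue_integral_def set_lebesgue_integral_def)
  also have "\<dots> = (\<integral>x. e * ?k (b + e * x) \<partial>lborel)"
    using e by (subst lborel_integral_real_affine[where c = e and t = b]) auto
  also have "\<dots> = (\<integral>x. indicator {0..} x *\<^sub>R (\<psi> (x * e) * - deriv f x) \<partial>lborel)"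
    \<comment> \<open>This form of the congruence does not ask for measurability of \<open>deriv f\<close>.\<close>
  proof (rule integral_discrete_difference[where X = "{0, (real_of_ereal S - b) / e}"])
    fix x assume x: "x \<notin> {0, (real_of_ereal S - b) / e}"
    have "ereal (x * e + b) \<noteq> S" using x e by (auto simp: field_simps)
    then have d: "deriv f x = - (e * (indicator (einterval b S) (x * e + b) * g (x * e + b)))"
      if "0 < x" using deriv_rescaled_profile[OF f e b'(1) that] by linarith
    show "e * ?k (b + e * x) = indicator {0..} x *\<^sub>R (\<psi> (x * e) * - deriv f x)"
    proof (cases "0 < x")
      case True
      then show ?thesis by (simp add: d algebra_simps)
    next
      case False
      then have "x < 0" "\<not> 0 < e * x" using x e by (auto simp: zero_less_mult_iff)
      then show ?thesis by (simp add: einterval_iff)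
    qed
  qed (auto simp: emeasure_lborel_countable)
  finally show ?thesis by (simp add: set_lebesgue_integral_def)
qed

lemma mean_volume_rescaled:
  assumes f: "\<And>x. 0 \<le> x \<Longrightarrow> w x t = w0 (x * h b + b)" and b: "b \<in> below S"
    and w_lim: "((w0 \<circ> real_of_ereal) \<longlongrightarrow> 0) (at_left S)"
    and yw_lim: "(((\<lambda>y. y * w0 y) \<circ> real_of_ereal) \<longlongrightarrow> 0) (at_left S)"
    and h_lim: "((h \<circ> real_of_ereal) \<longlongrightarrow> 0) (at_left S)"
  shows "mean_cluster_volume w t = 1 / w0 b"
proof -
  note gap = gap_integrals[OF b w_lim yw_lim h_lim]
  note resc = rescaled_density_integrals[OF f tail_pos[OF b] b]
  have "(LBINT x:{0..}. cluster_density w x t) = w0 b"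
    using resc[of "\<lambda>_. 1"] gap(1) by (simp add: cluster_density_def)
  moreover have "(LBINT x:{0..}. x * cluster_density w x t) = 1"
  proof -
    have "h b * (LBINT x:{0..}. x * cluster_density w x t)
        = (LBINT x:{0..}. x * h b * - deriv (\<lambda>x. w x t) x)"
      by (subst set_integral_mult_right[symmetric]) (simp add: cluster_density_def mult_ac)
    also have "\<dots> = h b" using resc[of "\<lambda>y. y"] gap(2) by simp
    finally show ?thesis using tail_pos[OF b] by simp
  qed
  ultimately show ?thesis by (simp add: mean_cluster_volume_def)
qed

end

section \<open>The time change\<close>

text \<open>The solution of \<open>B' = h(B)\<close>, \<open>B(0) = 0\<close>: the volume at time \<open>0\<close> of the clusters that
  disappear at time \<open>t\<close>. It maps \<open>[0, \<infinity>)\<close> increasingly onto \<open>[0, S)\<close>.\<close>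

locale time_change = tail_profile +
  fixes B :: "real \<Rightarrow> real"
  assumes start: "B 0 = 0"
    and derivative: "\<And>t. 0 \<le> t \<Longrightarrow> (B has_real_derivative h (B t)) (at t within {0..})"
    and below: "\<And>t. 0 \<le> t \<Longrightarrow> B t \<in> below S"
begin

lemma S_pos: "0 < S"
  using below[of 0] start by (simp add: below_def zero_ereal_def)

lemma B_mono: "0 \<le> s \<Longrightarrow> s \<le> t \<Longrightarrow> B s \<le> B t"
  by (rule halfline_nondecreasing[OF derivative]) (use below tail_pos in \<open>auto intro: less_imp_le\<close>)

lemma B_DERIV:
  assumes "0 < t"
  shows "(B has_real_derivative h (B t)) (at t)"
proof -
  have "at t within {0..} = at t"
    using assms by (intro at_within_open_subset[of _ "{0<..}"]) auto
  then show ?thesis using derivative[of t] assms by simp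
qed

lemma B_nonneg: "0 \<le> t \<Longrightarrow> 0 \<le> B t"
  using below by (simp add: below_def)

lemma B_eventually_gt:
  assumes y: "y \<in> below S"
  shows "eventually (\<lambda>t. y < B t) at_top"
proof -
  have "\<exists>t\<ge>0. y < B t"
  proof (rule ccontr)
    assume "\<not> ?thesis"
    then have le: "B t \<le> y" if "0 \<le> t" for t using that by force
    \<comment> \<open>Below \<open>y\<close> the speed is at least \<open>h y\<close>, so \<open>B\<close> would exceed \<open>y\<close> by this time.\<close>
    define t where "t = (y + 1) / h y"
    have hy: "0 < h y" and y0: "0 \<le> y" using tail_pos[OF y] y by (auto simp: below_def)
    have t0: "0 \<le> t" using hy y0 by (simp add: t_def)
    have "B 0 - 0 * h y \<le> B t - t * h y"
    proof (rule halfline_nondecreasing[where F = "\<lambda>s. B s - s * h y" and s = 0 and f = "\<lambda>s. h (B s) - h y"])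
      show "((\<lambda>s. B s - s * h y) has_real_derivative h (B s) - h y) (at s within {0..})"
        if "0 \<le> s" for s
        by (rule derivative_eq_intros refl derivative that)+ simp
      show "0 \<le> h (B s) - h y" if "0 \<le> s" for s
        using tail_antimono[of "B s" y] le B_nonneg that by simp
    qed (use t0 in auto)
    then show False using le[OF t0] hy start by (simp add: t_def)
  qed
  then obtain t0 where "0 \<le> t0" "y < B t0" by blast
  then show ?thesis
    using B_mono by (intro eventually_at_top_linorderI[of t0]) (meson less_le_trans)
qed

lemma B_filterlim: "filterlim (\<lambda>t. ereal (B t)) (at_left S) at_top"
  unfolding filterlim_at
proof
  have lt: "eventually (\<lambda>t. ereal (B t) < S) at_top"
    by (rule eventually_at_top_linorderI[of 0]) (use below in \<open>auto simp: below_def\<close>)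
  then show "eventually (\<lambda>t. ereal (B t) \<in> {..<S} \<and> ereal (B t) \<noteq> S) at_top"
    by eventually_elim auto
  show "((\<lambda>t. ereal (B t)) \<longlongrightarrow> S) at_top"
  proof (rule order_tendstoI)
    fix a assume "a < S"
    then have "max a 0 < S" using S_pos by simp
    then obtain y where y: "max a 0 < ereal y" "ereal y < S" using ereal_dense2 by blast
    then have "y \<in> below S" by (auto simp: below_def less_imp_le)
    then have "eventually (\<lambda>t. y < B t) at_top" by (rule B_eventually_gt)
    then show "eventually (\<lambda>t. a < ereal (B t)) at_top"
      by eventually_elim (use y(1) in \<open>auto intro: less_trans\<close>)
  next
    fix a assume "S < a"
    with lt show "eventually (\<lambda>t. ereal (B t) < a) at_top"
      by (auto elim!: eventually_mono intro: less_trans)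
  qed
qed

lemma B_continuous: "continuous_on {0..} B"
  by (rule DERIV_continuous_on) (use derivative in auto)

text \<open>Limits at \<open>S\<close> may be computed along \<open>B\<close>, by the intermediate value theorem.\<close>

lemma limit_at_S:
  fixes f :: "real \<Rightarrow> real"
  assumes "((\<lambda>t. f (B t)) \<longlongrightarrow> l) at_top"
  shows "((f \<circ> real_of_ereal) \<longlongrightarrow> l) (at_left S)"
proof (rule topological_tendstoI)
  fix U assume "open U" "l \<in> U"
  then have "eventually (\<lambda>t. f (B t) \<in> U) at_top"
    using assms by (simp add: tendsto_def)
  then obtain T where T: "\<And>t. T \<le> t \<Longrightarrow> f (B t) \<in> U"
    by (auto simp: eventually_at_top_linorder)
  define T0 where "T0 = max T 0"
  have "f (real_of_ereal u) \<in> U" if u: "u \<in> {ereal (B T0)<..<S}" for u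
  proof -
    obtain r where r: "u = ereal r" "B T0 < r" "ereal r < S"
      using u by (cases u) auto
    moreover have "0 \<le> B T0" by (rule B_nonneg) (simp add: T0_def)
    ultimately have "r \<in> below S" by (simp add: below_def)
    then have "eventually (\<lambda>t. T0 \<le> t \<and> r < B t) at_top"
      by (intro eventually_conj eventually_ge_at_top B_eventually_gt)
    then obtain t1 where t1: "T0 \<le> t1" "r < B t1"
      by (auto dest!: eventually_happens)
    have "continuous_on {T0..t1} B"
      by (rule continuous_on_subset[OF B_continuous]) (auto simp: T0_def)
    then obtain t where "T0 \<le> t" "B t = r"
      using IVT'[of B T0 r t1] r t1 by auto
    then show ?thesis using T[of t] r by (simp add: T0_def)
  qed
  moreover have "ereal (B T0) < S" using below[of T0] by (simp add: below_def T0_def)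
  ultimately have "eventually (\<lambda>u. f (real_of_ereal u) \<in> U) (at_left S)"
    by (intro eventually_at_leftI)
  then show "eventually (\<lambda>u. (f \<circ> real_of_ereal) u \<in> U) (at_left S)" by simp
qed

lemma tail_B_vanishes: "((\<lambda>t. h (B t)) \<longlongrightarrow> 0) at_top"
proof -
  \<comment> \<open>The cut-off provides a bound for all times: \<open>B\<close> is unspecified at negative ones.\<close>
  define v where "v y = indicator {0..} y *\<^sub>R w0 y" for y
  have v: "integrable lborel v"
    using integrable by (simp add: set_integrable_def v_def[abs_def])
  have v0: "0 \<le> v y" for y using nonneg by (simp add: v_def indicator_def)
  have "((\<lambda>t. \<integral>y. indicator {B t..} y *\<^sub>R v y \<partial>lborel) \<longlongrightarrow> (\<integral>y. 0 \<partial>(lborel :: real measure))) at_top"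
  proof (rule integral_dominated_convergence_at_top[where w = v])
    show "eventually (\<lambda>t. AE y in lborel. norm (indicator {B t..} y *\<^sub>R v y) \<le> v y) at_top"
      using v0 by (simp add: indicator_def)
    show "AE y in lborel. ((\<lambda>t. indicator {B t..} y *\<^sub>R v y) \<longlongrightarrow> 0) at_top"
    proof (rule AE_I2, rule tendsto_eventually)
      fix y :: real
      show "eventually (\<lambda>t. indicator {B t..} y *\<^sub>R v y = 0) at_top"
      proof (cases "y \<in> below S")
        case True
        show ?thesis using B_eventually_gt[OF True] by eventually_elim simp
      next
        case False
        then have "v y = 0" using nonneg[of y] by (force simp: below_iff v_def indicator_def)
        then show ?thesis by simp
      qed
    qed
    show "(\<lambda>y. indicator {B t..} y *\<^sub>R v y) \<in> borel_measurable lborel" for t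
      using borel_measurable_integrable[OF v] by measurable
  qed (use v in auto)
  then have lim: "((\<lambda>t. \<integral>y. indicator {B t..} y *\<^sub>R v y \<partial>lborel) \<longlongrightarrow> 0) at_top" by simp
  show ?thesis
  proof (rule Lim_transform_eventually[OF lim], rule eventually_at_top_linorderI[of 0])
    fix t :: real assume "0 \<le> t"
    then have "indicator {B t..} y *\<^sub>R v y = indicator {B t..} y *\<^sub>R w0 y" for y
      using B_nonneg[of t] by (auto simp: v_def indicator_def)
    then show "(\<integral>y. indicator {B t..} y *\<^sub>R v y \<partial>lborel) = h (B t)"
      unfolding tail_integral_def set_lebesgue_integral_def
      by (intro Bochner_Integration.integral_cong refl)
  qed
qed

lemma B_sublinear: "((\<lambda>t. B t / t) \<longlongrightarrow> 0) at_top"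
proof (rule lhospital_at_top_at_top[where f' = "\<lambda>t. h (B t)" and g' = "\<lambda>_. 1"])
  show "eventually (\<lambda>t. (B has_real_derivative h (B t)) (at t)) at_top"
    using eventually_gt_at_top[of 0] by eventually_elim (rule B_DERIV)
  show "((\<lambda>t. h (B t) / 1) \<longlongrightarrow> 0) at_top" using tail_B_vanishes by simp
qed (auto simp: filterlim_ident)

text \<open>The key identity \<open>L'(t) = \<beta>\<^sub>0(B(t))\<close>.\<close>

lemma mean_DERIV:
  assumes t: "0 < t" and B: "0 < B t"
  shows "((\<lambda>t. 1 / w0 (B t)) has_real_derivative beta_function S w0 (B t)) (at t)"
proof -
  have b: "B t \<in> below S" "ereal (B t) < S" "0 < w0 (B t)"
    using below[of t] t below_iff by (auto simp: below_def)
  have "((\<lambda>t. w0 (B t)) has_real_derivative - g (B t) * h (B t)) (at t)"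
    by (rule DERIV_chain2[where f = w0 and g = B, OF profile_DERIV[OF B b(2)] B_DERIV[OF t]])
  from DERIV_inverse'[OF this] show ?thesis
    using b by (simp add: beta_function_eq inverse_eq_divide power2_eq_square divide_simps)
qed

lemma mean_growth:
  assumes "((beta_function S w0 \<circ> real_of_ereal) \<longlongrightarrow> \<beta>) (at_left S)"
  shows "((\<lambda>t. (1 / w0 (B t)) / t) \<longlongrightarrow> \<beta>) at_top"
proof (rule lhospital_at_top_at_top[where f' = "\<lambda>t. beta_function S w0 (B t)" and g' = "\<lambda>_. 1"])
  have "0 \<in> below S" using below[of 0] start by simp
  then have "eventually (\<lambda>t. 0 < B t) at_top" by (rule B_eventually_gt)
  then show "eventually (\<lambda>t. ((\<lambda>t. 1 / w0 (B t)) has_real_derivative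
      beta_function S w0 (B t)) (at t)) at_top"
    using eventually_gt_at_top[of 0] by eventually_elim (rule mean_DERIV)
  show "((\<lambda>t. beta_function S w0 (B t) / 1) \<longlongrightarrow> \<beta>) at_top"
    using filterlim_compose[OF assms B_filterlim] by simp
qed (auto simp: filterlim_ident)

text \<open>A positive limit of the beta function rules out a jump of the profile at a finite \<open>S\<close>, and for
  \<open>S = \<infinity>\<close> the boundary term of the first moment vanishes.\<close>

lemma profile_limits:
  assumes "((beta_function S w0 \<circ> real_of_ereal) \<longlongrightarrow> \<beta>) (at_left S)" and "0 < \<beta>"
  shows "((w0 \<circ> real_of_ereal) \<longlongrightarrow> 0) (at_left S)"
    and "(((\<lambda>y. y * w0 y) \<circ> real_of_ereal) \<longlongrightarrow> 0) (at_left S)"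
proof -
  have rate: "((\<lambda>t. t * w0 (B t)) \<longlongrightarrow> 1 / \<beta>) at_top"
    using tendsto_inverse[OF mean_growth[OF assms(1)]] assms(2) by (simp add: field_simps)
  have pos: "eventually (\<lambda>t::real. 0 < t) at_top" by (rule eventually_gt_at_top)
  have "((\<lambda>t::real. 1 / t) \<longlongrightarrow> 0) at_top" by real_asymp
  from tendsto_mult[OF this rate] have "((\<lambda>t. (1 / t) * (t * w0 (B t))) \<longlongrightarrow> 0) at_top"
    by (simp only: mult_zero_left)
  then have "((\<lambda>t. w0 (B t)) \<longlongrightarrow> 0) at_top"
    by (rule Lim_transform_eventually) (use pos in eventually_elim, simp)
  then show "((w0 \<circ> real_of_ereal) \<longlongrightarrow> 0) (at_left S)" by (rule limit_at_S)
  from tendsto_mult[OF B_sublinear rate] have "((\<lambda>t. (B t / t) * (t * w0 (B t))) \<longlongrightarrow> 0) at_top"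
    by (simp only: mult_zero_left)
  then have "((\<lambda>t. B t * w0 (B t)) \<longlongrightarrow> 0) at_top"
    by (rule Lim_transform_eventually) (use pos in eventually_elim, simp)
  then show "(((\<lambda>y. y * w0 y) \<circ> real_of_ereal) \<longlongrightarrow> 0) (at_left S)"
    by (rule limit_at_S[of "\<lambda>y. y * w0 y"])
qed

end

section \<open>Linear growth of the mean cluster volume\<close>

theorem proposition4p4:
  fixes w0 :: "real \<Rightarrow> real" and w :: "real \<Rightarrow> real \<Rightarrow> real" and L :: "real \<Rightarrow> real"
    and M :: "'a measure" and X0 :: "'a \<Rightarrow> real" and beta_inf :: real
  assumes "\<And>x. 0 \<le> x \<Longrightarrow> 0 \<le> w0 x"
    and "antimono_on {0..} w0"
    and "set_integrable lborel {0..} w0"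
    and "(LBINT x:{0..}. w0 x) = 1"
    and "associated_rv M X0 w0"
    and "C2_on (below (rv_sup M X0)) (tail_integral w0)"
    and "bdd_above (beta_function (rv_sup M X0) w0 ` below (rv_sup M X0))"
    and "linear_LSW_solution w0 w L"
    and "L 0 = 1"
    and "((beta_function (rv_sup M X0) w0 \<circ> real_of_ereal) \<longlongrightarrow> beta_inf) (at_left (rv_sup M X0))"
    and "beta_inf > 0"
  shows "((\<lambda>T. mean_cluster_volume w T / T) \<longlongrightarrow> beta_inf) at_top"
proof -
  have w0_pos: "0 < w0 0"
  proof (rule ccontr)
    assume "\<not> 0 < w0 0"
    then have zero: "w0 x = 0" if "0 \<le> x" for x
      using assms(1)[OF that] monotone_onD[OF assms(2), of 0 x] that by simp
    have "(LBINT x:{0..}. w0 x) = (LBINT x::real:{0..}. 0)"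
      by (rule set_lebesgue_integral_cong) (use zero in auto)
    then show False using assms(4) by simp
  qed
  interpret tail_profile "rv_sup M X0" w0
    using assms(1-3,6) associated_rv_pos_iff[OF assms(5) w0_pos]
      associated_rv_right_continuous[OF assms(5) w0_pos]
    by unfold_locales auto
  obtain B where B: "B 0 = 0"
      "\<And>t. 0 \<le> t \<Longrightarrow> (B has_real_derivative tail_integral w0 (B t)) (at t within {0..})"
      "\<And>t. 0 \<le> t \<Longrightarrow> B t \<in> below (rv_sup M X0)"
    and w: "\<And>x t. 0 \<le> x \<Longrightarrow> 0 \<le> t \<Longrightarrow> w x t = w0 (x * tail_integral w0 (B t) + B t)"
    by (rule time_change_exists[OF assms(8)]) blast
  interpret time_change "rv_sup M X0" w0 B
    using B by unfold_locales
  note limits = profile_limits[OF assms(10,11)] limit_at_S[OF tail_B_vanishes]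
  have "mean_cluster_volume w t = 1 / w0 (B t)" if "0 \<le> t" for t
    using mean_volume_rescaled[OF w B(3) limits] that by simp
  then have "eventually (\<lambda>t. (1 / w0 (B t)) / t = mean_cluster_volume w t / t) at_top"
    by (intro eventually_at_top_linorderI[of 0]) simp
  then show ?thesis
    by (rule Lim_transform_eventually[OF mean_growth[OF assms(10)]])
qed

end
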